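(* If $G$ is a full DAG, then the flow polytope $\mathcal{F}_1(G)$ is Gorenstein.
   Context: A DAG is a finite directed acyclic graph, possibly with multiple edges; sources have no incoming edges, sinks no outgoing edges, all other vertices are inner. $G$ is full if every inner vertex has in-degree $2$ and out-degree $2$. The flow polytope $\mathcal{F}_1(G)\subset\mathbb{R}^{E(G)}$ is the set of $f:E(G)\to\mathbb{R}_{\ge0}$ with $\sum_{e\in\mathrm{in}(v)}f(e)=\sum_{e\in\mathrm{out}(v)}f(e)$ at every inner vertex $v$ and $\sum_{v\text{ source}}\sum_{e\in\mathrm{out}(v)}f(e)=1$; it is a lattice polytope whose vertices are the indicator vectors of routes (maximal directed paths). A lattice polytope $P$ is reflexive if there is an integer vector $\mathbf{v}$ and an integer matrix $A$ with $P+\mathbf{v}=\{\mathbf{x}:A\mathbf{x}\le\mathbf{1}\}$ (relative to its affine lattice), and Gorenstein of index $k$ if $kP$ is reflexive; equivalently, $\mathrm{cone}(P)=\mathrm{span}_{\mathbb{R}_{\ge0}}\{(1,\mathbf{p}):\mathbf{p}\in P\}$ is Gorenstein, i.e., there is a lattice point $\mathbf{c}$ with $\mathbf{c}+(\text{lattice}\cap \mathrm{cone}(P))=\text{lattice}\cap\mathrm{cone}(P)^\circ$. *)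

theory Defs
  imports "HOL-Analysis.Analysis" "Graph_Theory.Digraph"
begin

definition dag :: "('v, 'e) pre_digraph \<Rightarrow> bool" where
  "dag G \<longleftrightarrow> fin_digraph G \<and> acyclic (arcs_ends G)"

definition is_source :: "('v, 'e) pre_digraph \<Rightarrow> 'v \<Rightarrow> bool" where
  "is_source G v \<longleftrightarrow> v \<in> verts G \<and> in_arcs G v = {}"

definition is_sink :: "('v, 'e) pre_digraph \<Rightarrow> 'v \<Rightarrow> bool" where
  "is_sink G v \<longleftrightarrow> v \<in> verts G \<and> out_arcs G v = {}"

definition is_inner :: "('v, 'e) pre_digraph \<Rightarrow> 'v \<Rightarrow> bool" where
  "is_inner G v \<longleftrightarrow> v \<in> verts G \<and> \<not> is_source G v \<and> \<not> is_sink G v"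

definition full :: "('v, 'e) pre_digraph \<Rightarrow> bool" where
  "full G \<longleftrightarrow> (\<forall>v. is_inner G v \<longrightarrow> in_degree G v = 2 \<and> out_degree G v = 2)"

text \<open>The ambient space \<open>real ^ 'e\<close> is the space of real functions on the edges of \<open>G\<close>
  only if \<open>arcs G = UNIV\<close>; the definition is meant for such graphs.\<close>

definition flow_polytope :: "('v, 'e::finite) pre_digraph \<Rightarrow> (real ^ 'e) set" where
  "flow_polytope G = {f.
     (\<forall>e. 0 \<le> f $ e) \<and>
     (\<forall>v. is_inner G v \<longrightarrow> (\<Sum>e\<in>in_arcs G v. f $ e) = (\<Sum>e\<in>out_arcs G v. f $ e)) \<and>
     (\<Sum>v | is_source G v. \<Sum>e\<in>out_arcs G v. f $ e) = 1}"

definition integer_lattice :: "(real ^ 'n) set" where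
  "integer_lattice = {x. \<forall>i. x $ i \<in> \<int>}"

definition lattice_polytope :: "(real ^ 'n) set \<Rightarrow> bool" where
  "lattice_polytope P \<longleftrightarrow> (\<exists>S. finite S \<and> S \<subseteq> integer_lattice \<and> P = convex hull S)"

text \<open>The span of the differences of points of \<open>P\<close> is the linear space \<open>L\<close> parallel to the
  affine hull of \<open>P\<close>, so the equation below forces \<open>- v\<close> to be a lattice point of \<open>P\<close>, and
  \<open>P + v\<close> is described inside \<open>L\<close> with the lattice \<open>L \<inter> integer_lattice\<close>. The set
  \<open>A\<close> consists of the rows of the integer matrix. Since \<open>L \<inter> integer_lattice\<close> is a direct
  summand of \<open>integer_lattice\<close>, every linear form on \<open>L\<close> that is integral on it is given by an
  integer row.\<close>

definition reflexive_polytope :: "(real ^ 'n) set \<Rightarrow> bool" where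
  "reflexive_polytope P \<longleftrightarrow> lattice_polytope P \<and>
     (\<exists>v A. v \<in> integer_lattice \<and> finite A \<and> A \<subseteq> integer_lattice \<and>
        (\<lambda>p. p + v) ` P = {x \<in> span {p - q | p q. p \<in> P \<and> q \<in> P}. \<forall>a\<in>A. a \<bullet> x \<le> 1})"

definition gorenstein_of_index :: "nat \<Rightarrow> (real ^ 'n) set \<Rightarrow> bool" where
  "gorenstein_of_index k P \<longleftrightarrow>
     k \<ge> 1 \<and> lattice_polytope P \<and> reflexive_polytope ((\<lambda>p. real k *\<^sub>R p) ` P)"

definition gorenstein :: "(real ^ 'n) set \<Rightarrow> bool" where
  "gorenstein P \<longleftrightarrow> (\<exists>k. gorenstein_of_index k P)"

end

theory Submission
  imports Defs
begin

text \<open>In a full DAG the all-ones vector conserves flow at every inner vertex. Its value \<open>k\<close>, the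
  number of arcs leaving sources, is positive, so it is a lattice point of \<open>k F\<^sub>1(G)\<close>. All its
  coordinates are positive, so translating it to the origin turns each inequality \<open>0 \<le> f e\<close> into
  \<open>- x e \<le> 1\<close>, and the translated polytope spans the whole space of conserved vectors of value 0.
  That \<open>F\<^sub>1(G)\<close> is a lattice polytope follows by decomposing a flow into routes: subtract from it
  the largest possible multiple of a route inside its support and induct on the size of the
  support.\<close>

section \<open>Conservation and value of a flow as linear conditions\<close>

definition conserved :: "('v, 'e::finite) pre_digraph \<Rightarrow> real ^ 'e \<Rightarrow> bool" where
  "conserved G f \<longleftrightarrow>
     (\<forall>v. is_inner G v \<longrightarrow> (\<Sum>e\<in>in_arcs G v. f $ e) = (\<Sum>e\<in>out_arcs G v. f $ e))"

definition flow_value :: "('v, 'e::finite) pre_digraph \<Rightarrow> real ^ 'e \<Rightarrow> real" where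
  "flow_value G f = (\<Sum>v | is_source G v. \<Sum>e\<in>out_arcs G v. f $ e)"

lemma flow_polytope_iff:
  "f \<in> flow_polytope G \<longleftrightarrow> (\<forall>e. 0 \<le> f $ e) \<and> conserved G f \<and> flow_value G f = 1"
  by (simp add: flow_polytope_def conserved_def flow_value_def)

lemma linear_flow_value: "linear (flow_value G)"
  by (rule linearI) (simp_all add: flow_value_def sum.distrib sum_distrib_left)

lemma conserved_add: "conserved G f \<Longrightarrow> conserved G g \<Longrightarrow> conserved G (f + g)"
  by (simp add: conserved_def sum.distrib)

lemma conserved_scaleR: "conserved G f \<Longrightarrow> conserved G (c *\<^sub>R f)"
  by (simp add: conserved_def sum_distrib_left[symmetric])

lemma conserved_diff: "conserved G f \<Longrightarrow> conserved G g \<Longrightarrow> conserved G (f - g)"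
  by (simp add: conserved_def sum_subtractf)

text \<open>The conserved vectors of value 0 turn out to be the span of the differences of points of
  the dilated polytope; closure under linear operations gives one inclusion.\<close>

lemma subspace_circulations: "subspace {x. conserved G x \<and> flow_value G x = 0}"
  by (auto simp: subspace_def conserved_add conserved_scaleR linear_0[OF linear_flow_value]
      linear_add[OF linear_flow_value] linear_cmul[OF linear_flow_value])
    (simp add: conserved_def)

lemma convex_flow_polytope: "convex (flow_polytope G)"
  by (auto simp: convex_def flow_polytope_iff conserved_add conserved_scaleR
      linear_add[OF linear_flow_value] linear_cmul[OF linear_flow_value])

lemma finite_sources: "fin_digraph G \<Longrightarrow> finite {v. is_source G v}"
  by (rule finite_subset[of _ "verts G"]) (auto simp: is_source_def fin_digraph.finite_verts)

lemma arc_in_arcs_ends: "e \<in> arcs G \<Longrightarrow> (tail G e, head G e) \<in> arcs_ends G"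
  by (auto simp: arcs_ends_def arc_to_ends_def)

text \<open>Induction along the first relation walks backwards towards the sources, along the second
  forwards towards the sinks.\<close>

lemma dag_wf:
  assumes "dag G"
  shows "wf (arcs_ends G)" and "wf ((arcs_ends G)\<inverse>)"
proof -
  have "finite (arcs_ends G)"
    using assms by (auto simp: dag_def arcs_ends_def fin_digraph.finite_arcs)
  then show "wf (arcs_ends G)" "wf ((arcs_ends G)\<inverse>)"
    using assms by (auto simp: dag_def finite_acyclic_wf finite_acyclic_wf_converse)
qed

section \<open>Positive arcs, paths and routes in the support of a flow\<close>

context
  fixes G :: "('v, 'e::finite) pre_digraph"
  assumes arcs_UNIV: "arcs G = UNIV" and dag: "dag G"
begin

lemma fin_digraph_G: "fin_digraph G"
  using dag by (simp add: dag_def)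

lemma tail_cases: "is_source G (tail G e) \<or> is_inner G (tail G e)"
  using wf_digraph.tail_in_verts[OF fin_digraph.axioms(1)[OF fin_digraph_G], of e] arcs_UNIV
  by (auto simp: is_inner_def is_sink_def out_arcs_def)

lemma head_cases: "is_sink G (head G e) \<or> is_inner G (head G e)"
  using wf_digraph.head_in_verts[OF fin_digraph.axioms(1)[OF fin_digraph_G], of e] arcs_UNIV
  by (auto simp: is_inner_def is_source_def in_arcs_def)

lemma head_not_source: "\<not> is_source G (head G e)"
  using arcs_UNIV by (auto simp: is_source_def in_arcs_def)

lemma no_back_path: "(head G e, tail G e) \<notin> (arcs_ends G)\<^sup>*"
  using dag arc_in_arcs_ends[of e G] arcs_UNIV
  by (auto simp: dag_def acyclic_def dest: rtrancl_into_trancl2)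

text \<open>Walk backwards from \<open>e\<close>: at an inner tail the positive outflow forces
  positive inflow, hence a positive incoming arc. The walk cannot continue forever, so it ends at a
  source.\<close>

lemma positive_source_arc:
  assumes nonneg: "\<And>a. 0 \<le> f $ a" and cons: "conserved G f" and "0 < f $ e"
  shows "\<exists>a. is_source G (tail G a) \<and> 0 < f $ a"
  using \<open>0 < f $ e\<close>
proof (induction "tail G e" arbitrary: e rule: wf_induct_rule[OF dag_wf(1)[OF dag]])
  case (1 e)
  show ?case
  proof (cases "is_source G (tail G e)")
    case False
    then have "is_inner G (tail G e)"
      using tail_cases by blast
    then have "(\<Sum>a\<in>in_arcs G (tail G e). f $ a) = (\<Sum>a\<in>out_arcs G (tail G e). f $ a)"
      using cons by (simp add: conserved_def)
    also have "\<dots> > 0"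
      using 1(2) arcs_UNIV by (intro sum_pos2[of _ e]) (auto simp: nonneg)
    finally obtain a where "a \<in> in_arcs G (tail G e)" "0 < f $ a"
      using nonneg by (metis less_irrefl order_le_less sum.neutral)
    then show ?thesis
      using 1(1)[of a] arc_in_arcs_ends[of a G] by auto
  qed (use 1 in blast)
qed

text \<open>For the all-ones vector this yields a positive dilation factor.\<close>

lemma flow_value_pos:
  assumes nonneg: "\<And>a. 0 \<le> f $ a" and "conserved G f" and "0 < f $ e"
  shows "0 < flow_value G f"
proof -
  obtain a where a: "is_source G (tail G a)" "0 < f $ a"
    using positive_source_arc[OF assms] by blast
  have "0 < (\<Sum>b\<in>out_arcs G (tail G a). f $ b)"
    using a arcs_UNIV by (intro sum_pos2[of _ a]) (auto simp: nonneg)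
  then show ?thesis
    unfolding flow_value_def using a finite_sources[OF fin_digraph_G]
    by (intro sum_pos2[of _ "tail G a"]) (auto intro: sum_nonneg nonneg)
qed

text \<open>\<open>S\<close> is the arc set of a path from \<open>tail G e\<close> to a sink,
  recorded by degree counts instead of as a list. The path leaves its start without entering it,
  whence the correction by 1. The reachability clause serves the induction: it keeps a newly
  prepended arc out of \<open>S\<close>.\<close>

lemma path_to_sink:
  assumes nonneg: "\<And>a. 0 \<le> f $ a" and cons: "conserved G f" and "0 < f $ e"
  shows "\<exists>S. (\<forall>a\<in>S. 0 < f $ a) \<and> e \<in> S \<and> (\<forall>a\<in>S. (tail G e, tail G a) \<in> (arcs_ends G)\<^sup>*) \<and>
    (\<forall>v. is_inner G v \<longrightarrow>
       card (S \<inter> in_arcs G v) + (if v = tail G e then 1 else 0) = card (S \<inter> out_arcs G v)) \<and>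
    (\<forall>v. is_source G v \<longrightarrow> card (S \<inter> out_arcs G v) = (if v = tail G e then 1 else 0))"
  using \<open>0 < f $ e\<close>
proof (induction "head G e" arbitrary: e rule: wf_induct_rule[OF dag_wf(2)[OF dag]])
  case (1 e)
  have out_e: "e \<in> out_arcs G v \<longleftrightarrow> v = tail G e" and in_e: "e \<in> in_arcs G v \<longleftrightarrow> v = head G e" for v
    using arcs_UNIV by auto
  show ?case
  proof (cases "is_sink G (head G e)")
    case True
    \<comment> \<open>The final arc enters a vertex at which no balance is demanded, so the single
      arc \<open>e\<close> is enough.\<close>
    then have "\<not> is_inner G (head G e)"
      by (simp add: is_inner_def)
    then show ?thesis
      using 1(2) by (intro exI[of _ "{e}"])
        (auto simp: out_e in_e Int_insert_left simp del: in_in_arcs_conv in_out_arcs_conv)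
  next
    case False
    then have inner: "is_inner G (head G e)"
      using head_cases by blast
    have "0 < (\<Sum>a\<in>in_arcs G (head G e). f $ a)"
      using 1(2) arcs_UNIV by (intro sum_pos2[of _ e]) (auto simp: nonneg)
    also have "\<dots> = (\<Sum>a\<in>out_arcs G (head G e). f $ a)"
      using cons inner by (simp add: conserved_def)
    finally obtain b where b: "tail G b = head G e" "0 < f $ b"
      using nonneg by (metis in_out_arcs_conv less_irrefl order_le_less sum.neutral)
    then obtain S where S: "\<forall>a\<in>S. 0 < f $ a" "b \<in> S"
      and reach: "\<forall>a\<in>S. (head G e, tail G a) \<in> (arcs_ends G)\<^sup>*"
      and S_in: "\<forall>v. is_inner G v \<longrightarrow>
        card (S \<inter> in_arcs G v) + (if v = head G e then 1 else 0) = card (S \<inter> out_arcs G v)"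
      and S_src: "\<forall>v. is_source G v \<longrightarrow>
        card (S \<inter> out_arcs G v) = (if v = head G e then 1 else 0)"
      using 1(1)[of b] arc_in_arcs_ends[of b G] arcs_UNIV by auto
    \<comment> \<open>If \<open>e\<close> were in \<open>S\<close>, its tail would be reachable from
      its head, closing a cycle. Hence inserting \<open>e\<close> raises the counts at its two ends
      by exactly 1.\<close>
    have "e \<notin> S"
      using reach no_back_path by blast
    then have card_insert_out:
      "card (insert e S \<inter> out_arcs G v) = card (S \<inter> out_arcs G v) + (if v = tail G e then 1 else 0)"
      and card_insert_in:
      "card (insert e S \<inter> in_arcs G v) = card (S \<inter> in_arcs G v) + (if v = head G e then 1 else 0)" for v
      by (auto simp: Int_insert_left out_e in_e simp del: in_in_arcs_conv in_out_arcs_conv)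
    have "(tail G e, head G e) \<in> arcs_ends G"
      by (simp add: arc_in_arcs_ends arcs_UNIV)
    then have "\<forall>a\<in>insert e S. (tail G e, tail G a) \<in> (arcs_ends G)\<^sup>*"
      using reach by (auto intro: converse_rtrancl_into_rtrancl)
    moreover have "\<not> is_source G (head G e)"
      by (rule head_not_source)
    ultimately show ?thesis
      using S 1(2) S_in S_src
      by (intro exI[of _ "insert e S"]) (auto simp: card_insert_out card_insert_in)
  qed
qed

section \<open>Decomposition into routes and integrality of the vertices\<close>

text \<open>Taking the 0/1 points of the polytope avoids formalizing maximal paths and makes
  finiteness immediate; in a DAG these points are the indicator vectors of routes.\<close>

definition routes :: "(real ^ 'e) set" where
  "routes = flow_polytope G \<inter> range (\<lambda>S. \<chi> e. indicator S e)"

lemma finite_routes: "finite routes"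
  by (simp add: routes_def)

lemma route_in_support:
  assumes nonneg: "\<And>a. 0 \<le> f $ a" and cons: "conserved G f" and "0 < f $ e"
  obtains S where "(\<chi> a. indicator S a) \<in> routes" "\<forall>a\<in>S. 0 < f $ a" "S \<noteq> {}"
proof -
  obtain b where b: "is_source G (tail G b)" "0 < f $ b"
    using positive_source_arc[OF assms] by blast
  obtain S where S: "\<forall>a\<in>S. 0 < f $ a" "b \<in> S"
    and S_in: "\<forall>v. is_inner G v \<longrightarrow>
       card (S \<inter> in_arcs G v) + (if v = tail G b then 1 else 0) = card (S \<inter> out_arcs G v)"
    and S_src: "\<forall>v. is_source G v \<longrightarrow> card (S \<inter> out_arcs G v) = (if v = tail G b then 1 else 0)"
    using path_to_sink[OF nonneg cons b(2)] by blast
  let ?r = "(\<chi> a. indicator S a) :: real ^ 'e"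
  have sum_r: "(\<Sum>a\<in>A. ?r $ a) = card (S \<inter> A)" for A
    by (simp add: indicator_def Int_commute Collect_conj_eq flip: sum.inter_filter)
  \<comment> \<open>The path starts at a source, so the correction by 1 affects no inner vertex and
    the counts become conservation.\<close>
  have "\<not> is_inner G (tail G b)"
    using b by (simp add: is_inner_def)
  then have "conserved G ?r"
    unfolding conserved_def sum_r using S_in by (metis add.right_neutral)
  moreover have "flow_value G ?r = (\<Sum>v | is_source G v. if v = tail G b then 1 else 0)"
    unfolding flow_value_def sum_r using S_src by (intro sum.cong) auto
  then have "flow_value G ?r = 1"
    using b finite_sources[OF fin_digraph_G] by simp
  ultimately have "?r \<in> routes"
    by (simp add: routes_def flow_polytope_iff)
  then show ?thesis
    using that S by blast
qed

text \<open>The value of \<open>f\<close> is left free because subtracting a multiple of a route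
  lowers it; thus the coefficients are only required to be nonnegative.\<close>

lemma route_decomposition:
  assumes "\<And>a. 0 \<le> f $ a" and "conserved G f"
  shows "\<exists>u. (\<forall>r\<in>routes. 0 \<le> u r) \<and> f = (\<Sum>r\<in>routes. u r *\<^sub>R r)"
  using assms
proof (induction "card {a. f $ a \<noteq> 0}" arbitrary: f rule: less_induct)
  case less
  show ?case
  proof (cases "f = 0")
    case True
    then show ?thesis
      by (intro exI[of _ "\<lambda>_. 0"]) simp
  next
    case False
    then obtain e where "0 < f $ e"
      using less.prems(1) by (metis order_le_less vec_eq_iff zero_index)
    then obtain S where S: "(\<chi> a. indicator S a) \<in> routes" "\<forall>a\<in>S. 0 < f $ a" "S \<noteq> {}"
      using route_in_support[OF less.prems] by blast
    let ?r = "(\<chi> a. indicator S a) :: real ^ 'e"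
    \<comment> \<open>The bottleneck arc of the route: \<open>f $ m\<close> is the largest multiple
      that keeps the difference nonnegative, and \<open>m\<close> leaves the support.\<close>
    define m where "m = arg_min_on (\<lambda>a. f $ a) S"
    have m: "m \<in> S" "\<And>a. a \<in> S \<Longrightarrow> f $ m \<le> f $ a"
      unfolding m_def using S(3) by (auto intro: arg_min_if_finite(1) arg_min_least)
    define g where "g = f - f $ m *\<^sub>R ?r"
    have g: "g $ a = (if a \<in> S then f $ a - f $ m else f $ a)" for a
      by (simp add: g_def)
    have "{a. g $ a \<noteq> 0} \<subseteq> {a. f $ a \<noteq> 0}"
      using S(2) by (auto simp: g)
    moreover have "m \<in> {a. f $ a \<noteq> 0}" "m \<notin> {a. g $ a \<noteq> 0}"
      using m(1) S(2) by (auto simp: g)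
    ultimately have "{a. g $ a \<noteq> 0} \<subset> {a. f $ a \<noteq> 0}"
      by blast
    then have "card {a. g $ a \<noteq> 0} < card {a. f $ a \<noteq> 0}"
      by (intro psubset_card_mono) auto
    moreover have "0 \<le> g $ a" for a
      using m(2) less.prems(1) by (simp add: g)
    moreover have "conserved G g"
      using S(1) less.prems(2)
      by (auto simp: g_def routes_def flow_polytope_iff intro: conserved_diff conserved_scaleR)
    ultimately obtain u where u: "\<forall>r\<in>routes. 0 \<le> u r" "g = (\<Sum>r\<in>routes. u r *\<^sub>R r)"
      using less.hyps by blast
    \<comment> \<open>The route may already occur in the decomposition of \<open>g\<close>, so its
      coefficient is increased, not set.\<close>
    let ?u = "\<lambda>r. u r + (if r = ?r then f $ m else 0)"
    have "(\<Sum>r\<in>routes. ?u r *\<^sub>R r) = g + (\<Sum>r\<in>routes. if r = ?r then f $ m *\<^sub>R r else 0)"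
      unfolding u(2) sum.distrib[symmetric] by (rule sum.cong) (auto simp: scaleR_add_left)
    also have "\<dots> = f"
      using S(1) finite_routes by (simp add: g_def)
    finally show ?thesis
      using u(1) less.prems(1) by (intro exI[of _ ?u]) auto
  qed
qed

text \<open>The value is linear and equals 1 on every route, so the coefficients in a decomposition
  of a flow of value 1 sum to 1.\<close>

lemma flow_polytope_eq_hull: "flow_polytope G = convex hull routes"
proof
  show "convex hull routes \<subseteq> flow_polytope G"
    by (rule hull_minimal) (auto simp: routes_def convex_flow_polytope)
  show "flow_polytope G \<subseteq> convex hull routes"
  proof
    fix f assume f: "f \<in> flow_polytope G"
    then obtain u where u: "\<forall>r\<in>routes. 0 \<le> u r" "f = (\<Sum>r\<in>routes. u r *\<^sub>R r)"
      using route_decomposition[of f] by (auto simp: flow_polytope_iff)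
    have "1 = flow_value G f"
      using f by (simp add: flow_polytope_iff)
    also have "\<dots> = (\<Sum>r\<in>routes. u r * flow_value G r)"
      by (simp add: u(2) linear_sum[OF linear_flow_value] linear_cmul[OF linear_flow_value])
    also have "\<dots> = (\<Sum>r\<in>routes. u r)"
      by (rule sum.cong) (auto simp: routes_def flow_polytope_iff)
    finally show "f \<in> convex hull routes"
      unfolding convex_hull_finite[OF finite_routes] using u by auto
  qed
qed

lemma lattice_polytope_flow_polytope: "lattice_polytope (flow_polytope G)"
proof -
  have "routes \<subseteq> integer_lattice"
    by (auto simp: routes_def integer_lattice_def indicator_def)
  then show ?thesis
    unfolding lattice_polytope_def using finite_routes flow_polytope_eq_hull by blast
qed

end

section \<open>Dilation and reflexivity\<close>

lemma lattice_polytope_scaleR: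
  assumes "lattice_polytope P"
  shows "lattice_polytope ((\<lambda>p. real k *\<^sub>R p) ` P)"
proof -
  obtain S where "finite S" "S \<subseteq> integer_lattice" "P = convex hull S"
    using assms by (auto simp: lattice_polytope_def)
  then show ?thesis
    unfolding lattice_polytope_def
    by (intro exI[of _ "(\<lambda>p. real k *\<^sub>R p) ` S"])
      (auto simp: convex_hull_scaling integer_lattice_def)
qed

lemma scaled_flow_polytope_iff:
  assumes "0 < k"
  shows "f \<in> (\<lambda>p. k *\<^sub>R p) ` flow_polytope G \<longleftrightarrow>
    (\<forall>e. 0 \<le> f $ e) \<and> conserved G f \<and> flow_value G f = k"
proof
  assume "f \<in> (\<lambda>p. k *\<^sub>R p) ` flow_polytope G"
  then show "(\<forall>e. 0 \<le> f $ e) \<and> conserved G f \<and> flow_value G f = k"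
    using assms by (auto simp: flow_polytope_iff conserved_scaleR linear_cmul[OF linear_flow_value])
next
  assume "(\<forall>e. 0 \<le> f $ e) \<and> conserved G f \<and> flow_value G f = k"
  then have "inverse k *\<^sub>R f \<in> flow_polytope G"
    using assms by (auto simp: flow_polytope_iff conserved_scaleR linear_cmul[OF linear_flow_value])
  then show "f \<in> (\<lambda>p. k *\<^sub>R p) ` flow_polytope G"
    using assms by (intro image_eqI[of _ _ "inverse k *\<^sub>R f"]) auto
qed

text \<open>Fullness enters here: at an inner vertex the two sums are the in-degree and the
  out-degree, both 2.\<close>

lemma conserved_one:
  assumes "full G"
  shows "conserved G 1"
  using assms by (auto simp: conserved_def full_def in_degree_def out_degree_def)

text \<open>The row \<open>- axis e 1\<close> expresses \<open>- x $ e \<le> 1\<close>, which is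
  nonnegativity of coordinate \<open>e\<close> of \<open>x + 1\<close>.\<close>

lemma translate_scaled_flow_polytope:
  fixes G :: "('v, 'e::finite) pre_digraph"
  assumes k: "0 < k" "flow_value G 1 = k" and one: "conserved G 1"
  defines "Q \<equiv> (\<lambda>p. k *\<^sub>R p) ` flow_polytope G"
  shows "(\<lambda>p. p + (-1)) ` Q =
    {x \<in> span {p - q | p q. p \<in> Q \<and> q \<in> Q}. \<forall>a\<in>range (\<lambda>e. - axis e 1). a \<bullet> x \<le> 1}"
proof -
  let ?L = "{x. conserved G x \<and> flow_value G x = 0}"
  note Q_iff = scaled_flow_polytope_iff[OF k(1), of _ G, folded Q_def]
  have one_Q: "1 \<in> Q"
    using one k by (simp add: Q_iff)
  have span_eq: "span {p - q | p q. p \<in> Q \<and> q \<in> Q} = ?L"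
  proof
    show "span {p - q | p q. p \<in> Q \<and> q \<in> Q} \<subseteq> ?L"
      by (rule span_minimal)
        (auto simp: Q_iff conserved_diff linear_diff[OF linear_flow_value] subspace_circulations)
    show "?L \<subseteq> span {p - q | p q. p \<in> Q \<and> q \<in> Q}"
    proof
      fix x assume x: "x \<in> ?L"
      \<comment> \<open>Small enough that \<open>1 + c *\<^sub>R x\<close> stays nonnegative, since
        coordinates are bounded by the norm; the added 1 covers \<open>x = 0\<close>.\<close>
      define c where "c = inverse (norm x + 1)"
      have c: "0 < c"
        by (simp add: c_def add_nonneg_pos)
      have "0 \<le> 1 + c * x $ e" for e
      proof -
        have "- x $ e \<le> norm x + 1"
          using component_le_norm_cart[of x e] by linarith
        then have "c * (- x $ e) \<le> c * (norm x + 1)"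
          using c by (intro mult_left_mono) auto
        moreover have "c * (norm x + 1) = 1"
          unfolding c_def by (rule left_inverse) (smt (verit) norm_ge_zero)
        ultimately show ?thesis
          by simp
      qed
      then have "1 + c *\<^sub>R x \<in> Q"
        using x one k by (auto simp: Q_iff conserved_add conserved_scaleR
            linear_add[OF linear_flow_value] linear_cmul[OF linear_flow_value])
      \<comment> \<open>Thus \<open>x\<close> is a multiple of a difference of two points of
        \<open>Q\<close>.\<close>
      then have "(1 + c *\<^sub>R x) - 1 \<in> span {p - q | p q. p \<in> Q \<and> q \<in> Q}"
        using one_Q by (intro span_base) blast
      then have "inverse c *\<^sub>R ((1 + c *\<^sub>R x) - 1) \<in> span {p - q | p q. p \<in> Q \<and> q \<in> Q}"
        by (rule span_scale)
      then show "x \<in> span {p - q | p q. p \<in> Q \<and> q \<in> Q}"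
        using c by simp
    qed
  qed
  have shift: "x \<in> (\<lambda>p. p + (-1)) ` Q \<longleftrightarrow> x + 1 \<in> Q" for x
    by (auto simp: image_iff intro!: bexI[of _ "x + 1"])
  \<comment> \<open>Shifting by the all-ones vector preserves conservation and changes the value by
    \<open>k\<close>, so value \<open>k\<close> of \<open>x + 1\<close> means value 0 of
    \<open>x\<close>.\<close>
  have "conserved G (x + 1) \<longleftrightarrow> conserved G x" for x
    using conserved_add[OF _ one, of x] conserved_diff[OF _ one, of "x + 1"] by auto
  then have "x + 1 \<in> Q \<longleftrightarrow> x \<in> ?L \<and> (\<forall>e. - x $ e \<le> 1)" for x
    using k(2) by (auto simp: Q_iff linear_add[OF linear_flow_value] minus_le_iff
        add.commute[of _ "1::real"] real_0_le_add_iff)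
  then show ?thesis
    unfolding span_eq using shift by (auto simp: inner_axis' set_eq_iff)
qed

theorem theorem6p14:
  fixes G :: "('v, 'e::finite) pre_digraph"
  assumes "arcs G = UNIV"
    and "dag G"
    and "full G"
  shows "gorenstein (flow_polytope G)"
proof -
  note one = conserved_one[OF \<open>full G\<close>]
  define k where "k = (\<Sum>v | is_source G v. card (out_arcs G v))"
  have value_one: "flow_value G 1 = real k"
    by (simp add: flow_value_def k_def)
  \<comment> \<open>Types are nonempty and every element of \<open>'e\<close> is an arc, so
    \<open>undefined\<close> names an arc on which the all-ones vector is positive.\<close>
  have "0 < real k"
    using flow_value_pos[OF assms(1,2) _ one, of undefined] by (simp add: value_one)
  have lattice: "lattice_polytope (flow_polytope G)"
    by (rule lattice_polytope_flow_polytope[OF assms(1,2)])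
  have "reflexive_polytope ((\<lambda>p. real k *\<^sub>R p) ` flow_polytope G)"
    unfolding reflexive_polytope_def
  proof (intro conjI exI)
    show "lattice_polytope ((\<lambda>p. real k *\<^sub>R p) ` flow_polytope G)"
      by (rule lattice_polytope_scaleR[OF lattice])
    show "(-1 :: real ^ 'e) \<in> integer_lattice"
      by (simp add: integer_lattice_def)
    show "finite (range (\<lambda>e::'e. - axis e 1 :: real ^ 'e))"
      by simp
    show "range (\<lambda>e::'e. - axis e 1 :: real ^ 'e) \<subseteq> integer_lattice"
      by (auto simp: integer_lattice_def axis_def)
  qed (rule translate_scaled_flow_polytope[OF \<open>0 < real k\<close> value_one one])
  then show ?thesis
    using lattice \<open>0 < real k\<close> by (auto simp: gorenstein_def gorenstein_of_index_def Suc_le_eq)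
qed

end
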